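(* The following problem is undecidable: given a finite-valued nondeterministic finite transducer $T$, decide whether $T$ has bounded trailing.
   Context: An NFT is a sextuple $T=(Q,\Sigma,\Gamma,\delta,q_0,F)$ with a finite nonempty state set $Q$, finite nonempty input alphabet $\Sigma$, finite nonempty output alphabet $\Gamma$, initial state $q_0\in Q$, accepting states $F\subseteq Q$, and transition function $\delta$ mapping each $(q,\sigma)\in Q\times\Sigma$ to a finite subset of $Q\times\Gamma^\ast$. We write $q\xrightarrow{a/u}q'$ if $T$ can go from $q$ to $q'$ while reading $a\in\Sigma^\ast$ and producing $u\in\Gamma^\ast$, the concatenation of the outputs of the individual transitions (for $a$ empty, $q'=q$ and $u$ empty). $L(T)$ is the set of $(a,u)$ with $q_0\xrightarrow{a/u}f$ for some $f\in F$. $T$ is finite-valued if there is $k\in\mathbb{N}$ such that every $a\in\Sigma^\ast$ has at most $k$ words $u$ with $(a,u)\in L(T)$. $T$ has bounded trailing if there is $t\in\mathbb{N}$ such that for all $q_1,q_2\in Q$, $f_1,f_2\in F$, $a,b_1,b_2\in\Sigma^\ast$, $u,v,w_1,w_2\in\Gamma^\ast$: if $q_0\xrightarrow{a/uv}q_1\xrightarrow{b_1/w_1}f_1$ and $q_0\xrightarrow{a/u}q_2\xrightarrow{b_2/vw_2}f_2$, then $|v|\le t$. *)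

theory Defs
  imports Main "HOL-Library.Nat_Bijection"
begin

section \<open>Nondeterministic finite transducers\<close>

record ('q, 's, 'g) nft =
  states :: "'q set"
  input_alphabet :: "'s set"
  output_alphabet :: "'g set"
  delta :: "'q \<Rightarrow> 's \<Rightarrow> ('q \<times> 'g list) set"
  initial :: 'q
  accepting :: "'q set"

definition is_nft :: "('q, 's, 'g) nft \<Rightarrow> bool" where
  "is_nft T \<longleftrightarrow>
     finite (states T) \<and> states T \<noteq> {} \<and>
     finite (input_alphabet T) \<and> input_alphabet T \<noteq> {} \<and>
     finite (output_alphabet T) \<and> output_alphabet T \<noteq> {} \<and>
     initial T \<in> states T \<and> accepting T \<subseteq> states T \<and>
     (\<forall>q\<in>states T. \<forall>s\<in>input_alphabet T.
        finite (delta T q s) \<and> delta T q s \<subseteq> states T \<times> lists (output_alphabet T))"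

text \<open>The values of \<open>delta T\<close> outside \<open>states T \<times> input_alphabet T\<close> carry no meaning;
  the membership premises below keep them from influencing the runs.\<close>

inductive run :: "('q, 's, 'g) nft \<Rightarrow> 'q \<Rightarrow> 's list \<Rightarrow> 'g list \<Rightarrow> 'q \<Rightarrow> bool"
  for T :: "('q, 's, 'g) nft" where
  run_Nil: "q \<in> states T \<Longrightarrow> run T q [] [] q"
| run_Cons: "q \<in> states T \<Longrightarrow> s \<in> input_alphabet T \<Longrightarrow> (p, u) \<in> delta T q s \<Longrightarrow>
    run T p a v q' \<Longrightarrow> run T q (s # a) (u @ v) q'"

definition nft_lang :: "('q, 's, 'g) nft \<Rightarrow> ('s list \<times> 'g list) set" where
  "nft_lang T = {(a, u). \<exists>f\<in>accepting T. run T (initial T) a u f}"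

definition finite_valued :: "('q, 's, 'g) nft \<Rightarrow> bool" where
  "finite_valued T \<longleftrightarrow>
     (\<exists>k::nat. \<forall>a\<in>lists (input_alphabet T).
        finite {u. (a, u) \<in> nft_lang T} \<and> card {u. (a, u) \<in> nft_lang T} \<le> k)"

definition bounded_trailing :: "('q, 's, 'g) nft \<Rightarrow> bool" where
  "bounded_trailing T \<longleftrightarrow>
     (\<exists>t::nat. \<forall>q1\<in>states T. \<forall>q2\<in>states T. \<forall>f1\<in>accepting T. \<forall>f2\<in>accepting T.
        \<forall>a\<in>lists (input_alphabet T). \<forall>b1\<in>lists (input_alphabet T). \<forall>b2\<in>lists (input_alphabet T).
        \<forall>u\<in>lists (output_alphabet T). \<forall>v\<in>lists (output_alphabet T).
        \<forall>w1\<in>lists (output_alphabet T). \<forall>w2\<in>lists (output_alphabet T).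
          run T (initial T) a (u @ v) q1 \<and> run T q1 b1 w1 f1 \<and>
          run T (initial T) a u q2 \<and> run T q2 b2 (v @ w2) f2
          \<longrightarrow> length v \<le> t)"


section \<open>Partial recursive functions\<close>

text \<open>Kleene's schemes (zero, successor, projections, composition, primitive recursion,
  minimisation). Terms carry no arity annotations: the length of the argument list fixes the
  arity of every subterm, and a term used at a wrong arity is simply undefined there.
  \<open>eval f xs y\<close> means that \<open>f\<close> is defined on \<open>xs\<close> with value \<open>y\<close>.\<close>

datatype recf =
  Zero
| Succ
| Proj nat
| Comp recf "recf list"
| PrimRec recf recf
| Mu recf

inductive eval :: "recf \<Rightarrow> nat list \<Rightarrow> nat \<Rightarrow> bool" where
  eval_Zero: "eval Zero xs 0"
| eval_Succ: "eval Succ [x] (Suc x)"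
| eval_Proj: "i < length xs \<Longrightarrow> eval (Proj i) xs (xs ! i)"
| eval_Comp: "list_all2 (\<lambda>g y. eval g xs y) gs ys \<Longrightarrow> eval f ys z \<Longrightarrow> eval (Comp f gs) xs z"
| eval_PrimRec_0: "eval f xs y \<Longrightarrow> eval (PrimRec f g) (0 # xs) y"
| eval_PrimRec_Suc: "eval (PrimRec f g) (n # xs) r \<Longrightarrow> eval g (n # r # xs) y \<Longrightarrow>
    eval (PrimRec f g) (Suc n # xs) y"
| eval_Mu: "eval f (n # xs) 0 \<Longrightarrow> (\<forall>m<n. \<exists>y. eval f (m # xs) (Suc y)) \<Longrightarrow> eval (Mu f) xs n"

text \<open>Decidability of the problem ``given \<open>x\<close> with \<open>P x\<close>, does \<open>Y x\<close> hold?'', where \<open>code x c\<close>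
  says that the number \<open>c\<close> is an encoding of the instance \<open>x\<close>. The algorithm has to halt with
  the right answer on every encoding of an instance satisfying \<open>P\<close>; on all other inputs it may
  diverge or answer arbitrarily.\<close>

definition decidable_given :: "('a \<Rightarrow> nat \<Rightarrow> bool) \<Rightarrow> ('a \<Rightarrow> bool) \<Rightarrow> ('a \<Rightarrow> bool) \<Rightarrow> bool" where
  "decidable_given code P Y \<longleftrightarrow>
     (\<exists>d. \<forall>x c. P x \<and> code x c \<longrightarrow> eval d [c] (if Y x then 1 else 0))"


section \<open>Transducers as inputs of algorithms\<close>

text \<open>An algorithm receives a transducer whose states and letters are natural numbers (any
  transducer is of this form up to renaming) as a sextuple of explicit finite listings, in any
  order and possibly with repetitions.\<close>

definition encode_transition :: "nat \<times> nat \<times> nat \<times> nat list \<Rightarrow> nat" where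
  "encode_transition = (\<lambda>(q, s, p, u). list_encode [q, s, p, list_encode u])"

definition nft_code :: "(nat, nat, nat) nft \<Rightarrow> nat \<Rightarrow> bool" where
  "nft_code T c \<longleftrightarrow>
     (\<exists>qs ss gs ds fs.
        set qs = states T \<and> set ss = input_alphabet T \<and> set gs = output_alphabet T \<and>
        set ds = {(q, s, p, u). q \<in> states T \<and> s \<in> input_alphabet T \<and> (p, u) \<in> delta T q s} \<and>
        set fs = accepting T \<and>
        c = list_encode [list_encode qs, list_encode ss, list_encode gs,
              list_encode (map encode_transition ds), initial T, list_encode fs])"

end

theory Submission imports Defs begin

text \<open>Let two runs read the letters of a queue as they are dequeued: one run copies its input,
  the other one outputs the initial queue and then, letter by letter, what a deterministic queue
  machine enqueues. If the output of the copying run is a prefix of the other one, then the input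
  is the sequence of letters that the machine really dequeues, and the trailing word is the current
  contents of the queue. So the union of the two sequential transducers, which has at most three
  outputs per input, has bounded trailing if the machine halts, and not if its queue grows forever.
  Queue machines simulate counter machines, hence compute all partial recursive functions.
  Given a decision procedure \<open>d\<close>, a queue machine whose initial queue spells out the data needed to
  build the code of its own transducer runs \<open>d\<close> on this code and then does the opposite of the
  answer. As \<open>d\<close> halts on this input, only defined values of recursive functions have to be
  simulated.\<close>

section \<open>Arithmetic of list codes by Kleene's schemes\<close>

lemma eval_Comp1: "eval g xs y \<Longrightarrow> eval f [y] z \<Longrightarrow> eval (Comp f [g]) xs z"
  by (rule eval_Comp[of _ _ "[y]"]) auto

lemma eval_Comp2:
  "eval g xs y \<Longrightarrow> eval h xs y' \<Longrightarrow> eval f [y, y'] z \<Longrightarrow> eval (Comp f [g, h]) xs z"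
  by (rule eval_Comp[of _ _ "[y, y']"]) auto

lemma eval_Proj_eq: "i < length xs \<Longrightarrow> xs ! i = y \<Longrightarrow> eval (Proj i) xs y"
  using eval_Proj by blast

fun const_rf :: "nat \<Rightarrow> recf" where
  "const_rf 0 = Zero"
| "const_rf (Suc n) = Comp Succ [const_rf n]"

lemma eval_const: "eval (const_rf n) xs n"
  by (induction n) (auto intro: eval_Zero eval_Succ eval_Comp1)

definition add_rf :: recf where
  "add_rf = PrimRec (Proj 0) (Comp Succ [Proj 1])"

lemma eval_add: "eval add_rf [x, y] (x + y)"
  unfolding add_rf_def
  by (induction x) (auto intro!: eval_PrimRec_0 eval_PrimRec_Suc eval_Proj_eq eval_Comp1 eval_Succ)

definition triangle_rf :: recf where
  "triangle_rf = PrimRec Zero (Comp add_rf [Proj 1, Comp Succ [Proj 0]])"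

lemma eval_triangle: "eval triangle_rf [n] (triangle n)"
proof (induction n)
  case 0
  then show ?case
    unfolding triangle_rf_def by (auto intro: eval_PrimRec_0 eval_Zero)
next
  case (Suc n)
  have "eval (Comp add_rf [Proj 1, Comp Succ [Proj 0]]) [n, triangle n] (triangle n + Suc n)"
    by (rule eval_Comp2[OF eval_Proj_eq eval_Comp1[OF eval_Proj_eq eval_Succ] eval_add]) auto
  with Suc show ?case
    unfolding triangle_rf_def by (auto intro: eval_PrimRec_Suc)
qed

text \<open>This is \<open>list_encode\<close> of a nonempty list, unfolded: the successor of the
  Cantor pairing \<open>triangle (x + y) + x\<close>.\<close>

definition cons_rf :: recf where
  "cons_rf = Comp Succ [Comp add_rf [Comp triangle_rf [add_rf], Proj 0]]"

lemma eval_cons: "eval cons_rf [x, list_encode xs] (list_encode (x # xs))"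
  unfolding cons_rf_def list_encode.simps prod_encode_def prod.case
  by (rule eval_Comp1[OF eval_Comp2[OF eval_Comp1[OF eval_add eval_triangle] eval_Proj_eq eval_add]
        eval_Succ]) auto

lemma eval_Comp_cons:
  "eval f xs y \<Longrightarrow> eval g xs (list_encode ys) \<Longrightarrow> eval (Comp cons_rf [f, g]) xs (list_encode (y # ys))"
  using eval_Comp2 eval_cons by blast

fun list_rf :: "recf list \<Rightarrow> recf" where
  "list_rf [] = Zero"
| "list_rf (f # fs) = Comp cons_rf [f, list_rf fs]"

lemma eval_list:
  "list_all2 (\<lambda>f y. eval f xs y) fs ys \<Longrightarrow> eval (list_rf fs) xs (list_encode ys)"
  by (induction fs ys rule: list_all2_induct) (auto intro: eval_Comp_cons eval_Zero simp del: list_encode.simps(2))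

definition replicate_rf :: "nat \<Rightarrow> recf" where
  "replicate_rf a = PrimRec (Proj 0) (Comp cons_rf [const_rf a, Proj 1])"

lemma eval_replicate:
  "eval (replicate_rf a) [n, list_encode xs] (list_encode (replicate n a @ xs))"
proof (induction n)
  case 0
  then show ?case
    unfolding replicate_rf_def by (auto intro!: eval_PrimRec_0 eval_Proj_eq)
next
  case (Suc n)
  have "eval (Comp cons_rf [const_rf a, Proj 1]) [n, list_encode (replicate n a @ xs), list_encode xs]
      (list_encode (a # replicate n a @ xs))"
    by (rule eval_Comp_cons[OF eval_const eval_Proj_eq]) auto
  with Suc show ?case
    unfolding replicate_rf_def by (auto intro: eval_PrimRec_Suc simp del: list_encode.simps)
qed


section \<open>Loop programs\<close>

text \<open>\<open>Loop\<close> tests its register before every round and decrements it on entry,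
  and the body may set it again. So it is a while loop, as unbounded minimisation requires.\<close>

datatype cmd = Inc nat | Dec nat | Seq cmd cmd | Loop nat cmd

inductive exec :: "cmd \<Rightarrow> (nat \<Rightarrow> nat) \<Rightarrow> (nat \<Rightarrow> nat) \<Rightarrow> bool" where
  exec_Inc: "exec (Inc r) s (s(r := Suc (s r)))"
| exec_Dec: "exec (Dec r) s (s(r := s r - 1))"
| exec_Seq: "exec c s s' \<Longrightarrow> exec d s' s'' \<Longrightarrow> exec (Seq c d) s s''"
| exec_Loop_0: "s r = 0 \<Longrightarrow> exec (Loop r c) s s"
| exec_Loop_Suc: "0 < s r \<Longrightarrow> exec c (s(r := s r - 1)) s' \<Longrightarrow> exec (Loop r c) s' s'' \<Longrightarrow>
    exec (Loop r c) s s''"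

definition Clear :: "nat \<Rightarrow> cmd" where
  "Clear r = Loop r (Dec r)"

lemma exec_Clear: "exec (Clear r) s (s(r := 0))"
proof (induction "s r" arbitrary: s rule: less_induct)
  case less
  show ?case
  proof (cases "s r = 0")
    case True
    then have "s(r := 0) = s" by auto
    with True show ?thesis
      unfolding Clear_def by (simp add: exec_Loop_0)
  next
    case False
    let ?s = "s(r := s r - 1, r := (s(r := s r - 1)) r - 1)"
    have "exec (Clear r) ?s (?s(r := 0))"
      using False by (intro less) auto
    then have 1: "exec (Loop r (Dec r)) ?s (s(r := 0))"
      unfolding Clear_def by simp
    show ?thesis
      unfolding Clear_def by (rule exec_Loop_Suc[OF _ exec_Dec 1]) (use False in simp)
  qed
qed

lemma exec_Loop_Inc: "r \<noteq> d \<Longrightarrow> exec (Loop r (Inc d)) s (s(r := 0, d := s d + s r))"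
proof (induction "s r" arbitrary: s)
  case 0
  then have "s(r := 0, d := s d + s r) = s" by auto
  then show ?case using exec_Loop_0[of s r] 0 by metis
next
  case (Suc n)
  let ?s = "s(r := s r - 1, d := Suc ((s(r := s r - 1)) d))"
  have "exec (Loop r (Inc d)) ?s (?s(r := 0, d := ?s d + ?s r))"
    using Suc by (intro Suc) auto
  also have "?s(r := 0, d := ?s d + ?s r) = s(r := 0, d := s d + s r)"
    using Suc by (auto simp: fun_eq_iff)
  finally have 1: "exec (Loop r (Inc d)) ?s (s(r := 0, d := s d + s r))" .
  show ?case
    by (rule exec_Loop_Suc[OF _ exec_Inc 1]) (use Suc.hyps(2) in simp)
qed

lemma exec_Loop_Inc_Inc:
  "r \<noteq> d \<Longrightarrow> r \<noteq> t \<Longrightarrow> d \<noteq> t \<Longrightarrow>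
    exec (Loop r (Seq (Inc d) (Inc t))) s (s(r := 0, d := s d + s r, t := s t + s r))"
proof (induction "s r" arbitrary: s)
  case 0
  then have "s(r := 0, d := s d + s r, t := s t + s r) = s" by auto
  then show ?case using exec_Loop_0[of s r] 0 by metis
next
  case (Suc n)
  let ?s = "s(r := s r - 1, d := Suc (s d), t := Suc (s t))"
  have 1: "exec (Seq (Inc d) (Inc t)) (s(r := s r - 1)) ?s"
    using exec_Seq[OF exec_Inc[of d "s(r := s r - 1)"] exec_Inc[of t]] Suc.prems by simp
  have "exec (Loop r (Seq (Inc d) (Inc t))) ?s (?s(r := 0, d := ?s d + ?s r, t := ?s t + ?s r))"
    using Suc by (intro Suc) auto
  also have "?s(r := 0, d := ?s d + ?s r, t := ?s t + ?s r) = s(r := 0, d := s d + s r, t := s t + s r)"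
    using Suc.hyps(2) Suc.prems by (auto simp: fun_eq_iff)
  finally have 2: "exec (Loop r (Seq (Inc d) (Inc t))) ?s (s(r := 0, d := s d + s r, t := s t + s r))" .
  show ?case
    by (rule exec_Loop_Suc[OF _ 1 2]) (use Suc.hyps(2) in simp)
qed

text \<open>Reading a counter destroys it, so \<open>r\<close> is drained into \<open>d\<close> and
  \<open>t\<close> at once and then restored from \<open>t\<close>.\<close>

definition Copy :: "nat \<Rightarrow> nat \<Rightarrow> nat \<Rightarrow> cmd" where
  "Copy r d t = Seq (Clear d) (Seq (Clear t) (Seq (Loop r (Seq (Inc d) (Inc t))) (Loop t (Inc r))))"

lemma exec_Copy:
  assumes "r \<noteq> d" "r \<noteq> t" "d \<noteq> t"
  shows "exec (Copy r d t) s (s(d := s r, t := 0))"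
proof -
  let ?s = "s(d := 0, t := 0)"
  let ?s' = "?s(r := 0, d := ?s d + ?s r, t := ?s t + ?s r)"
  have "exec (Copy r d t) s (?s'(t := 0, r := ?s' r + ?s' t))"
    unfolding Copy_def
    by (rule exec_Seq[OF exec_Clear exec_Seq[OF exec_Clear exec_Seq[OF exec_Loop_Inc_Inc exec_Loop_Inc]]])
      (use assms in auto)
  also have "?s'(t := 0, r := ?s' r + ?s' t) = s(d := s r, t := 0)"
    using assms by (auto simp: fun_eq_iff)
  finally show ?thesis .
qed


section \<open>Compiling recursive functions to loop programs\<close>

text \<open>The registers \<open>as\<close> hold the arguments, \<open>d\<close> receives the result, and the registers from \<open>k\<close>
  on are scratch with arbitrary initial contents.\<close>

fun compile :: "recf \<Rightarrow> nat list \<Rightarrow> nat \<Rightarrow> nat \<Rightarrow> cmd"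
  and compiles :: "recf list \<Rightarrow> nat list \<Rightarrow> nat \<Rightarrow> nat \<Rightarrow> cmd" where
  "compile Zero as d k = Clear d"
| "compile Succ as d k = Seq (Copy (hd as) d k) (Inc d)"
| "compile (Proj i) as d k = Copy (as ! i) d k"
| "compile (Comp f gs) as d k =
    Seq (compiles gs as k (k + length gs)) (compile f [k..<k + length gs] d (k + length gs))"
| "compile (PrimRec f g) as d k =
    Seq (compile f (tl as) d (k + 4))
      (Seq (Clear k)
        (Seq (Copy (hd as) (k + 1) (k + 3))
          (Loop (k + 1)
            (Seq (compile g (k # d # tl as) (k + 2) (k + 4)) (Seq (Copy (k + 2) d (k + 3)) (Inc k))))))"
| "compile (Mu f) as d k =
    Seq (Clear d) (Seq (compile f (d # as) k (k + 1))
      (Loop k (Seq (Inc d) (compile f (d # as) k (k + 1)))))"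
| "compiles [] as d k = Clear k"
| "compiles (g # gs) as d k = Seq (compile g as d k) (compiles gs as (Suc d) k)"

text \<open>Only defined values are simulated. The result register must not be an argument, because
  the code for \<open>PrimRec\<close> and \<open>Mu\<close> uses it as accumulator or candidate
  while the arguments are still being read.\<close>

definition compile_spec :: "recf \<Rightarrow> bool" where
  "compile_spec f \<longleftrightarrow> (\<forall>as d k s y.
     eval f (map s as) y \<and> set as \<subseteq> {..<k} \<and> d < k \<and> d \<notin> set as \<longrightarrow>
     (\<exists>s'. exec (compile f as d k) s s' \<and> s' d = y \<and> (\<forall>r<k. r \<noteq> d \<longrightarrow> s' r = s r)))"

lemma compile_specI:
  assumes "\<And>as d k s y. eval f (map s as) y \<Longrightarrow> set as \<subseteq> {..<k} \<Longrightarrow> d < k \<Longrightarrow> d \<notin> set as \<Longrightarrow>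
    \<exists>s'. exec (compile f as d k) s s' \<and> s' d = y \<and> (\<forall>r<k. r \<noteq> d \<longrightarrow> s' r = s r)"
  shows "compile_spec f"
  using assms unfolding compile_spec_def by blast

lemma compile_specD:
  assumes "compile_spec f" "eval f xs y" "xs = map s as" "set as \<subseteq> {..<k}" "d < k" "d \<notin> set as"
  obtains s' where "exec (compile f as d k) s s'" "s' d = y" "\<And>r. r < k \<Longrightarrow> r \<noteq> d \<Longrightarrow> s' r = s r"
  using assms unfolding compile_spec_def by blast

inductive_cases eval_ZeroE: "eval Zero xs y"
inductive_cases eval_SuccE: "eval Succ xs y"
inductive_cases eval_ProjE: "eval (Proj i) xs y"
inductive_cases eval_CompE: "eval (Comp f gs) xs y"
inductive_cases eval_PrimRecE: "eval (PrimRec f g) xs y"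
inductive_cases eval_PrimRec_0E: "eval (PrimRec f g) (0 # xs) y"
inductive_cases eval_PrimRec_SucE: "eval (PrimRec f g) (Suc n # xs) y"
inductive_cases eval_MuE: "eval (Mu f) xs y"

section \<open>Correctness of the compiler, scheme by scheme\<close>

lemma compile_spec_Zero: "compile_spec Zero"
proof (rule compile_specI)
  fix as :: "nat list" and d k :: nat and s :: "nat \<Rightarrow> nat" and y
  assume "eval Zero (map s as) y"
  then have "y = 0" by (auto elim: eval_ZeroE)
  then show "\<exists>s'. exec (compile Zero as d k) s s' \<and> s' d = y \<and> (\<forall>r<k. r \<noteq> d \<longrightarrow> s' r = s r)"
    by (intro exI[of _ "s(d := 0)"]) (simp add: exec_Clear)
qed

lemma compile_spec_Succ: "compile_spec Succ"
proof (rule compile_specI)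
  fix as :: "nat list" and d k :: nat and s :: "nat \<Rightarrow> nat" and y
  assume "eval Succ (map s as) y" and *: "set as \<subseteq> {..<k}" "d < k" "d \<notin> set as"
  then obtain a where a: "as = [a]" "y = Suc (s a)" by (auto elim: eval_SuccE)
  let ?s = "s(d := s a, k := 0)"
  have "exec (compile Succ as d k) s (?s(d := Suc (?s d)))"
    using exec_Seq[OF exec_Copy exec_Inc, of a d k d s] a * by simp
  then show "\<exists>s'. exec (compile Succ as d k) s s' \<and> s' d = y \<and> (\<forall>r<k. r \<noteq> d \<longrightarrow> s' r = s r)"
    by (intro exI[of _ "?s(d := Suc (?s d))"]) (use * a in auto)
qed

lemma compile_spec_Proj: "compile_spec (Proj i)"
proof (rule compile_specI)
  fix as :: "nat list" and d k :: nat and s :: "nat \<Rightarrow> nat" and y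
  assume "eval (Proj i) (map s as) y" and *: "set as \<subseteq> {..<k}" "d < k" "d \<notin> set as"
  then have a: "i < length as" "y = s (as ! i)" by (auto elim: eval_ProjE)
  then have "as ! i \<in> set as" by simp
  then have "as ! i < k" "as ! i \<noteq> d" using * by auto
  then have "exec (compile (Proj i) as d k) s (s(d := s (as ! i), k := 0))"
    using * by (auto intro!: exec_Copy)
  then show "\<exists>s'. exec (compile (Proj i) as d k) s s' \<and> s' d = y \<and> (\<forall>r<k. r \<noteq> d \<longrightarrow> s' r = s r)"
    by (intro exI[of _ "s(d := s (as ! i), k := 0)"]) (use * a in auto)
qed

text \<open>The results go to consecutive registers, and every later computation preserves the
  earlier ones. As there is no skip command, the empty list clears the scratch register
  \<open>k\<close>.\<close>

lemma compiles_correct: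
  assumes "list_all2 (\<lambda>g y. eval g xs y) gs ys" "\<And>g. g \<in> set gs \<Longrightarrow> compile_spec g"
    and "xs = map s as" "set as \<subseteq> {..<d}" "d + length gs = k"
  shows "\<exists>s'. exec (compiles gs as d k) s s' \<and> map s' [d..<k] = ys \<and> (\<forall>r<d. s' r = s r)"
  using assms
proof (induction gs ys arbitrary: s d rule: list_all2_induct)
  case Nil
  then have "exec (compiles [] as d k) s (s(k := 0))" "d = k"
    by (simp_all add: exec_Clear del: fun_upd_apply)
  then show ?case
    by (intro exI[of _ "s(k := 0)"]) (auto simp del: fun_upd_apply, simp)
next
  case (Cons g gs y ys)
  have d: "set as \<subseteq> {..<k}" "d < k" "d \<notin> set as"
    using Cons.prems by auto
  have "compile_spec g" using Cons.prems(1) by simp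
  then obtain s1 where s1: "exec (compile g as d k) s s1" "s1 d = y" "\<And>r. r < k \<Longrightarrow> r \<noteq> d \<Longrightarrow> s1 r = s r"
    using compile_specD[OF _ Cons.hyps(1) Cons.prems(2) d] by blast
  have eq: "xs = map s1 as"
    unfolding Cons.prems(2) by (intro map_cong refl s1(3)[symmetric]) (use d in auto)
  have "\<exists>s2. exec (compiles gs as (Suc d) k) s1 s2 \<and> map s2 [Suc d..<k] = ys \<and> (\<forall>r<Suc d. s2 r = s1 r)"
    by (rule Cons.IH[OF _ eq]) (use Cons.prems in auto)
  then obtain s2 where s2: "exec (compiles gs as (Suc d) k) s1 s2" "map s2 [Suc d..<k] = ys"
    "\<forall>r<Suc d. s2 r = s1 r"
    by blast
  have "map s2 [d..<k] = y # ys"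
    using s2 s1(2) \<open>d < k\<close> by (simp add: upt_conv_Cons)
  with s1 s2 \<open>d < k\<close> show ?case
    by (intro exI[of _ s2]) (auto intro: exec_Seq)
qed

lemma compile_spec_Comp:
  assumes "compile_spec f" "\<And>g. g \<in> set gs \<Longrightarrow> compile_spec g"
  shows "compile_spec (Comp f gs)"
proof (rule compile_specI)
  fix as :: "nat list" and d k :: nat and s :: "nat \<Rightarrow> nat" and y
  assume "eval (Comp f gs) (map s as) y" and *: "set as \<subseteq> {..<k}" "d < k" "d \<notin> set as"
  then obtain ys where ys: "list_all2 (\<lambda>g y. eval g (map s as) y) gs ys" "eval f ys y"
    by (auto elim: eval_CompE)
  let ?k = "k + length gs"
  obtain s1 where s1: "exec (compiles gs as k ?k) s s1" "map s1 [k..<?k] = ys" "\<forall>r<k. s1 r = s r"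
    using compiles_correct[OF ys(1) assms(2) refl *(1) refl] by blast
  obtain s2 where s2: "exec (compile f [k..<?k] d ?k) s1 s2" "s2 d = y"
    "\<And>r. r < ?k \<Longrightarrow> r \<noteq> d \<Longrightarrow> s2 r = s1 r"
    by (rule compile_specD[OF assms(1) ys(2) s1(2)[symmetric], of ?k d]) (use * in auto)
  show "\<exists>s'. exec (compile (Comp f gs) as d k) s s' \<and> s' d = y \<and> (\<forall>r<k. r \<noteq> d \<longrightarrow> s' r = s r)"
    using s1 s2 by (intro exI[of _ s2]) (auto intro: exec_Seq)
qed

text \<open>The derivation descends from \<open>n\<close> to 0, whereas the loop ascends. Collecting
  all intermediate values in \<open>\<rho>\<close> gives the loop an invariant to refer to.\<close>

lemma eval_PrimRec_sequence:
  "eval (PrimRec f g) (n # xs) y \<Longrightarrow>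
    \<exists>\<rho>. eval f xs (\<rho> 0) \<and> (\<forall>i<n. eval g (i # \<rho> i # xs) (\<rho> (Suc i))) \<and> \<rho> n = y"
proof (induction n arbitrary: y)
  case 0
  then show ?case by (intro exI[of _ "\<lambda>_. y"]) (auto elim: eval_PrimRec_0E)
next
  case (Suc n)
  then obtain r where r: "eval (PrimRec f g) (n # xs) r" "eval g (n # r # xs) y"
    by (auto elim: eval_PrimRec_SucE)
  from Suc.IH[OF r(1)] obtain \<rho> where
    "eval f xs (\<rho> 0)" "\<forall>i<n. eval g (i # \<rho> i # xs) (\<rho> (Suc i))" "\<rho> n = r"
    by (elim exE conjE)
  with r(2) show ?case
    by (intro exI[of _ "\<rho>(Suc n := y)"]) (auto simp: less_Suc_eq)
qed

lemma compile_spec_PrimRec: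
  assumes "compile_spec f" "compile_spec g"
  shows "compile_spec (PrimRec f g)"
proof (rule compile_specI)
  fix as' :: "nat list" and d k :: nat and s :: "nat \<Rightarrow> nat" and y
  assume ev: "eval (PrimRec f g) (map s as') y" and *: "set as' \<subseteq> {..<k}" "d < k" "d \<notin> set as'"
  from ev obtain a as where as': "as' = a # as"
    by (cases rule: eval_PrimRecE) auto
  let ?xs = "map s as"
  obtain \<rho> where \<rho>: "eval f ?xs (\<rho> 0)" "\<And>i. i < s a \<Longrightarrow> eval g (i # \<rho> i # ?xs) (\<rho> (Suc i))" "\<rho> (s a) = y"
    using eval_PrimRec_sequence[OF ev[unfolded as' list.map]] by (elim exE conjE) simp
  have as: "set as \<subseteq> {..<k}" "d \<notin> set as" "a < k" "a \<noteq> d"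
    using * as' by auto
  let ?body = "Seq (compile g (k # d # as) (k + 2) (k + 4)) (Seq (Copy (k + 2) d (k + 3)) (Inc k))"
  \<comment> \<open>Invariant: \<open>k\<close> counts the finished rounds, \<open>k + 1\<close> the
    remaining ones, and \<open>d\<close> holds the intermediate value reached. Register
    \<open>k + 2\<close> receives the next value, and \<open>k + 3\<close> is scratch for
    copying.\<close>
  have loop: "\<exists>s2. exec (Loop (k + 1) ?body) s1 s2 \<and> s2 d = y \<and> (\<forall>r<k. r \<noteq> d \<longrightarrow> s2 r = s r)"
    if "s1 k + s1 (k + 1) = s a" "s1 d = \<rho> (s1 k)" "\<forall>r<k. r \<noteq> d \<longrightarrow> s1 r = s r" for s1
    using that
  proof (induction "s1 (k + 1)" arbitrary: s1)
    case 0
    then show ?case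
      using \<rho>(3) by (intro exI[of _ s1]) (auto intro: exec_Loop_0)
  next
    case (Suc n)
    let ?s = "s1(k + 1 := s1 (k + 1) - 1)"
    have eq: "map s1 as = ?xs"
      using as Suc.prems(3) by (auto simp: map_eq_conv)
    have map: "s1 k # \<rho> (s1 k) # ?xs = map ?s (k # d # as)"
      using as *(2) Suc.prems(2) eq by (auto simp: map_eq_conv)
    have "s1 k < s a" using Suc by simp
    obtain s2 where s2: "exec (compile g (k # d # as) (k + 2) (k + 4)) ?s s2"
      "s2 (k + 2) = \<rho> (Suc (s1 k))" "\<And>r. r < k + 4 \<Longrightarrow> r \<noteq> k + 2 \<Longrightarrow> s2 r = ?s r"
      by (rule compile_specD[OF assms(2) \<rho>(2)[OF \<open>s1 k < s a\<close>] map, of "k + 4" "k + 2"])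
        (use as *(2) in auto)
    let ?s3 = "s2(d := s2 (k + 2), k + 3 := 0)"
    let ?s4 = "?s3(k := Suc (?s3 k))"
    have body: "exec ?body ?s ?s4"
      by (rule exec_Seq[OF s2(1) exec_Seq[OF _ exec_Inc]], rule exec_Copy) (use *(2) in auto)
    have s4: "?s4 k = Suc (s1 k)" "?s4 (k + 1) = n" "?s4 d = \<rho> (Suc (s1 k))"
      "\<forall>r<k. r \<noteq> d \<longrightarrow> ?s4 r = s r"
      using s2 *(2) Suc.hyps(2) Suc.prems(3) by auto
    have "\<exists>s5. exec (Loop (k + 1) ?body) ?s4 s5 \<and> s5 d = y \<and> (\<forall>r<k. r \<noteq> d \<longrightarrow> s5 r = s r)"
    proof (rule Suc.hyps(1))
      show "n = ?s4 (k + 1)" using s4(2) by simp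
      show "?s4 k + ?s4 (k + 1) = s a" unfolding s4(1,2) using Suc by simp
      show "?s4 d = \<rho> (?s4 k)" unfolding s4(1,3) ..
      show "\<forall>r<k. r \<noteq> d \<longrightarrow> ?s4 r = s r" by (rule s4(4))
    qed
    then obtain s5 where s5: "exec (Loop (k + 1) ?body) ?s4 s5" "s5 d = y" "\<forall>r<k. r \<noteq> d \<longrightarrow> s5 r = s r"
      by (elim exE conjE)
    have "exec (Loop (k + 1) ?body) s1 s5"
      by (rule exec_Loop_Suc[OF _ body s5(1)]) (use Suc.hyps(2) in simp)
    with s5(2,3) show ?case
      by (intro exI conjI)
  qed
  obtain s1 where s1: "exec (compile f as d (k + 4)) s s1" "s1 d = \<rho> 0"
    "\<And>r. r < k + 4 \<Longrightarrow> r \<noteq> d \<Longrightarrow> s1 r = s r"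
    by (rule compile_specD[OF assms(1) \<rho>(1) refl, of "k + 4" d]) (use as *(2) in auto)
  let ?s2 = "s1(k := 0)"
  let ?s3 = "?s2(k + 1 := ?s2 a, k + 3 := 0)"
  have "\<exists>s4. exec (Loop (k + 1) ?body) ?s3 s4 \<and> s4 d = y \<and> (\<forall>r<k. r \<noteq> d \<longrightarrow> s4 r = s r)"
    by (rule loop) (use s1 as *(2) in auto)
  then obtain s4 where s4: "exec (Loop (k + 1) ?body) ?s3 s4" "s4 d = y" "\<forall>r<k. r \<noteq> d \<longrightarrow> s4 r = s r"
    by (elim exE conjE)
  have "exec (compile (PrimRec f g) as' d k) s s4"
    unfolding as' compile.simps list.sel
    by (rule exec_Seq[OF s1(1) exec_Seq[OF exec_Clear exec_Seq[OF _ s4(1)]]], rule exec_Copy)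
      (use as in auto)
  with s4(2,3) show "\<exists>s'. exec (compile (PrimRec f g) as' d k) s s' \<and> s' d = y \<and> (\<forall>r<k. r \<noteq> d \<longrightarrow> s' r = s r)"
    by (intro exI[of _ s4]) simp
qed

lemma compile_spec_Mu:
  assumes "compile_spec f"
  shows "compile_spec (Mu f)"
proof (rule compile_specI)
  fix as :: "nat list" and d k :: nat and s :: "nat \<Rightarrow> nat" and y
  assume "eval (Mu f) (map s as) y" and *: "set as \<subseteq> {..<k}" "d < k" "d \<notin> set as"
  then have f0: "eval f (y # map s as) 0" and f1: "\<forall>m<y. \<exists>z. eval f (m # map s as) (Suc z)"
    by (auto elim: eval_MuE)
  let ?c = "compile f (d # as) k (k + 1)"
  \<comment> \<open>Testing a candidate up to \<open>y\<close> terminates, because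
    \<open>eval_Mu\<close> demands defined positive values at all smaller arguments; the result
    vanishes exactly at \<open>y\<close>.\<close>
  have ex: "\<exists>s'. exec ?c s1 s' \<and> (s' k = 0 \<longleftrightarrow> s1 d = y) \<and> (\<forall>r<k. s' r = s1 r)"
    if le: "s1 d \<le> y" and eq: "\<forall>r<k. r \<noteq> d \<longrightarrow> s1 r = s r" for s1
  proof -
    have "map s1 as = map s as"
      using * eq by (auto simp: map_eq_conv)
    then have map: "s1 d # map s as = map s1 (d # as)" by simp
    obtain z where z: "eval f (s1 d # map s as) z" "z = 0 \<longleftrightarrow> s1 d = y"
    proof (cases "s1 d = y")
      case True
      with f0 show ?thesis by (intro that[of 0]) simp_all
    next
      case False
      with le f1 obtain z where "eval f (s1 d # map s as) (Suc z)" by force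
      with False show ?thesis by (intro that[of "Suc z"]) simp_all
    qed
    obtain s' where s': "exec ?c s1 s'" "s' k = z" "\<And>r. r < k + 1 \<Longrightarrow> r \<noteq> k \<Longrightarrow> s' r = s1 r"
      by (rule compile_specD[OF assms z(1) map, of "k + 1" k]) (use * in auto)
    show ?thesis
      by (intro exI[of _ s'] conjI s'(1)) (use z s' in auto)
  qed
  \<comment> \<open>Invariant: \<open>d\<close> is the candidate and \<open>k\<close> vanishes
    exactly if it is \<open>y\<close>. The decrement of \<open>k\<close> on entering a round does no
    harm, since the body computes \<open>k\<close> afresh.\<close>
  have loop: "\<exists>s2. exec (Loop k (Seq (Inc d) ?c)) s1 s2 \<and> s2 d = y \<and> (\<forall>r<k. r \<noteq> d \<longrightarrow> s2 r = s r)"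
    if "s1 d \<le> y" "\<forall>r<k. r \<noteq> d \<longrightarrow> s1 r = s r" "s1 k = 0 \<longleftrightarrow> s1 d = y" for s1
    using that
  proof (induction "y - s1 d" arbitrary: s1 rule: less_induct)
    case less
    show ?case
    proof (cases "s1 d = y")
      case True
      with less.prems show ?thesis
        by (intro exI[of _ s1]) (auto intro: exec_Loop_0)
    next
      case False
      let ?s = "s1(k := s1 k - 1)"
      let ?s2 = "?s(d := Suc (?s d))"
      have d: "?s2 d = Suc (s1 d)" using * by simp
      have "?s2 d \<le> y" "\<forall>r<k. r \<noteq> d \<longrightarrow> ?s2 r = s r"
        using False less.prems * by auto
      from ex[OF this] obtain s3 where s3: "exec ?c ?s2 s3" "s3 k = 0 \<longleftrightarrow> ?s2 d = y" "\<forall>r<k. s3 r = ?s2 r"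
        by (elim exE conjE)
      have s3d: "s3 d = Suc (s1 d)" using s3(3) *(2) by simp
      have "\<exists>s4. exec (Loop k (Seq (Inc d) ?c)) s3 s4 \<and> s4 d = y \<and> (\<forall>r<k. r \<noteq> d \<longrightarrow> s4 r = s r)"
        by (rule less.hyps) (use False less.prems s3 s3d d in auto)
      then obtain s4 where s4: "exec (Loop k (Seq (Inc d) ?c)) s3 s4" "s4 d = y" "\<forall>r<k. r \<noteq> d \<longrightarrow> s4 r = s r"
        by (elim exE conjE)
      have "exec (Loop k (Seq (Inc d) ?c)) s1 s4"
        by (rule exec_Loop_Suc[OF _ exec_Seq[OF exec_Inc s3(1)] s4(1)]) (use False less.prems in simp)
      with s4(2,3) show ?thesis
        by (intro exI conjI)
    qed
  qed
  let ?s1 = "s(d := 0)"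
  have "?s1 d \<le> y" "\<forall>r<k. r \<noteq> d \<longrightarrow> ?s1 r = s r" by auto
  from ex[OF this] obtain s2 where s2: "exec ?c ?s1 s2" "s2 k = 0 \<longleftrightarrow> ?s1 d = y" "\<forall>r<k. s2 r = ?s1 r"
    by (elim exE conjE)
  have "\<exists>s3. exec (Loop k (Seq (Inc d) ?c)) s2 s3 \<and> s3 d = y \<and> (\<forall>r<k. r \<noteq> d \<longrightarrow> s3 r = s r)"
    by (rule loop) (use s2 * in auto)
  with s2(1) show "\<exists>s'. exec (compile (Mu f) as d k) s s' \<and> s' d = y \<and> (\<forall>r<k. r \<noteq> d \<longrightarrow> s' r = s r)"
    by (auto intro: exec_Seq exec_Clear)
qed

lemma compile_correct: "compile_spec f"
  by (induction f)
    (auto intro: compile_spec_Zero compile_spec_Succ compile_spec_Proj compile_spec_Comp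
      compile_spec_PrimRec compile_spec_Mu)

section \<open>Counter machines as queue machines\<close>

text \<open>\<open>INC r e\<close> increments \<open>r\<close> and jumps to \<open>e\<close>; \<open>DEC r e z\<close> jumps to \<open>z\<close> if \<open>r\<close> is zero, and
  otherwise decrements \<open>r\<close> and jumps to \<open>e\<close>.\<close>

datatype instr = INC nat nat | DEC nat nat nat

primrec code_size :: "cmd \<Rightarrow> nat" where
  "code_size (Inc r) = 1"
| "code_size (Dec r) = 1"
| "code_size (Seq c d) = code_size c + code_size d"
| "code_size (Loop r c) = Suc (code_size c)"

text \<open>\<open>code c n e\<close> is to be placed at address \<open>n\<close> and leaves to address \<open>e\<close>.\<close>

primrec code :: "cmd \<Rightarrow> nat \<Rightarrow> nat \<Rightarrow> instr list" where
  "code (Inc r) n e = [INC r e]"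
| "code (Dec r) n e = [DEC r e e]"
| "code (Seq c d) n e = code c n (n + code_size c) @ code d (n + code_size c) e"
| "code (Loop r c) n e = DEC r (Suc n) e # code c (Suc n) n"

lemma length_code [simp]: "length (code c n e) = code_size c"
  by (induction c arbitrary: n e) auto

primrec code_at :: "instr list \<Rightarrow> nat \<Rightarrow> instr list \<Rightarrow> bool" where
  "code_at P n [] = True"
| "code_at P n (i # is) = (n < length P \<and> P ! n = i \<and> code_at P (Suc n) is)"

lemma code_at_append [simp]:
  "code_at P n (is @ js) \<longleftrightarrow> code_at P n is \<and> code_at P (n + length is) js"
  by (induction "is" arbitrary: n) auto

lemma code_at_infix: "code_at (ps @ is @ qs) (length ps) is"
proof (induction "is" arbitrary: ps)
  case (Cons i "is")
  then show ?case using Cons[of "ps @ [i]"] by simp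
qed simp

text \<open>A queue holds the counters in unary and in arbitrary order: the letter \<open>r + 2\<close> is a unit of
  register \<open>r\<close>, \<open>1\<close> is a blank, and a single end marker \<open>0\<close> serves to notice that the whole
  queue has been rotated. The machine is at instruction \<open>n\<close> in the states \<open>2 * n + 2\<close> and
  \<open>2 * n + 3\<close>; the latter says that a decrement has already met the end marker once. No step
  shortens the queue.\<close>

definition queue_trans :: "instr list \<Rightarrow> nat \<Rightarrow> nat \<Rightarrow> (nat \<times> nat list) option" where
  "queue_trans P q x =
    (if q < 2 \<or> length P \<le> (q - 2) div 2 then None
     else case P ! ((q - 2) div 2) of
       INC r e \<Rightarrow> Some (2 * e + 2, [x, r + 2])
     | DEC r e z \<Rightarrow>
         if x = r + 2 then Some (2 * e + 2, [1])
         else if x = 0 then if even q then Some (q + 1, [0]) else Some (2 * z + 2, [0])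
         else Some (q, [x]))"

inductive queue_step :: "instr list \<Rightarrow> nat \<times> nat list \<Rightarrow> nat \<times> nat list \<Rightarrow> bool" for P where
  queue_stepI: "queue_trans P q x = Some (p, u) \<Longrightarrow> queue_step P (q, x # w) (p, w @ u)"

lemma queue_step_deterministic: "queue_step P c c' \<Longrightarrow> queue_step P c c'' \<Longrightarrow> c' = c''"
  by (auto elim!: queue_step.cases)

text \<open>The bound on \<open>p\<close> keeps runs away from the states 0 and 1, which the
  transducer uses otherwise. The bounds on the output keep the queue from shrinking and its growth
  linear in the number of steps.\<close>

lemma queue_trans_output:
  "queue_trans P q x = Some (p, u) \<Longrightarrow> 2 \<le> p \<and> 1 \<le> length u \<and> length u \<le> 2"
  unfolding queue_trans_def by (auto split: if_splits instr.splits)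

section \<open>Simulation of counters by the contents of a queue\<close>

definition queue_repr :: "nat list \<Rightarrow> (nat \<Rightarrow> nat) \<Rightarrow> bool" where
  "queue_repr w s \<longleftrightarrow> count_list w 0 = 1 \<and> (\<forall>r. count_list w (r + 2) = s r)"

lemma queue_reprE:
  assumes "queue_repr w s"
  obtains y z where "w = y @ 0 # z" "0 \<notin> set y" "0 \<notin> set z"
proof -
  have 1: "count_list w 0 = 1" using assms by (simp add: queue_repr_def)
  then have "0 \<in> set w" by (metis count_notin zero_neq_one)
  then obtain y z where "w = y @ 0 # z" "0 \<notin> set y" by (meson split_list_first)
  with 1 show ?thesis by (intro that[of y z]) (auto simp: count_list_0_iff)
qed

lemma queue_rotate:
  "(\<And>x. x \<in> set y \<Longrightarrow> queue_trans P q x = Some (q, [x])) \<Longrightarrow>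
    (queue_step P)\<^sup>*\<^sup>* (q, y @ z) (q, z @ y)"
proof (induction y arbitrary: z)
  case (Cons x y)
  have "queue_step P (q, x # y @ z) (q, (y @ z) @ [x])"
    using Cons.prems by (intro queue_stepI) simp
  moreover have "(queue_step P)\<^sup>*\<^sup>* (q, y @ z @ [x]) (q, (z @ [x]) @ y)"
    using Cons.prems by (intro Cons.IH) simp
  ultimately show ?case by simp
qed simp

text \<open>Whatever letter stands first is put back together with the new unit. The end marker
  guarantees that there is such a letter.\<close>

lemma queue_INC:
  assumes "n < length P" "P ! n = INC r e" "queue_repr w s"
  obtains w' where "queue_step P (2 * n + 2, w) (2 * e + 2, w')" "queue_repr w' (s(r := Suc (s r)))"
proof -
  obtain x v where w: "w = x # v"
    using assms(3) by (cases w) (auto simp: queue_repr_def)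
  have "queue_step P (2 * n + 2, x # v) (2 * e + 2, v @ [x, r + 2])"
    using assms by (intro queue_stepI) (simp add: queue_trans_def)
  moreover have "count_list (v @ [x, r + 2]) y = count_list w y + (if y = r + 2 then 1 else 0)" for y
    by (simp add: w)
  then have "queue_repr (v @ [x, r + 2]) (s(r := Suc (s r)))"
    using assms(3) by (auto simp: queue_repr_def)
  ultimately show ?thesis using that w by blast
qed

text \<open>The queue rotates until a unit of \<open>r\<close> comes up, which is replaced by a
  blank. Between two meetings of the end marker every other letter has passed, so the second meeting
  proves that \<open>r\<close> is zero; after the first one, letters behind the marker are still
  unseen.\<close>

lemma queue_DEC:
  assumes "n < length P" "P ! n = DEC r e z" "queue_repr w s"
  obtains w' where "(queue_step P)\<^sup>*\<^sup>* (2 * n + 2, w) (2 * (if s r = 0 then z else e) + 2, w')"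
    "queue_repr w' (s(r := s r - 1))"
proof -
  let ?S = "queue_step P"
  have t: "queue_trans P q x =
      (if x = r + 2 then Some (2 * e + 2, [1])
       else if x = 0 then if q = 2 * n + 2 then Some (2 * n + 3, [0]) else Some (2 * z + 2, [0])
       else Some (q, [x]))" if "q = 2 * n + 2 \<or> q = 2 * n + 3" for q x
    using that assms(1,2) by (auto simp: queue_trans_def)
  have rot: "?S\<^sup>*\<^sup>* (q, a @ b) (q, b @ a)"
    if "q = 2 * n + 2 \<or> q = 2 * n + 3" "0 \<notin> set a" "r + 2 \<notin> set a" for q a b
  proof (rule queue_rotate)
    fix x assume "x \<in> set a"
    with that(2,3) have "x \<noteq> 0" "x \<noteq> r + 2" by metis+
    then show "queue_trans P q x = Some (q, [x])" by (simp add: t[OF that(1)])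
  qed
  have hash: "?S (2 * n + 2, 0 # b) (2 * n + 3, b @ [0])" "?S (2 * n + 3, 0 # b) (2 * z + 2, b @ [0])" for b
    by (rule queue_stepI; simp add: t)+
  have unit: "?S (q, (r + 2) # b) (2 * e + 2, b @ [1])" if "q = 2 * n + 2 \<or> q = 2 * n + 3" for q b
    by (rule queue_stepI) (simp add: t[OF that])
  show ?thesis
  proof (cases "s r = 0")
    case True
    obtain a b where w: "w = a @ 0 # b" "0 \<notin> set a" "0 \<notin> set b"
      using queue_reprE[OF assms(3)] .
    have "count_list w (r + 2) = 0" using assms(3) True by (simp add: queue_repr_def)
    then have nr: "r + 2 \<notin> set a" "r + 2 \<notin> set b" by (auto simp: w count_list_0_iff)
    have "?S\<^sup>*\<^sup>* (2 * n + 2, a @ 0 # b) (2 * n + 2, 0 # b @ a)"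
      using rot[of "2 * n + 2" a "0 # b"] w nr by simp
    also have "?S (2 * n + 2, 0 # b @ a) (2 * n + 3, (b @ a) @ [0])" by (rule hash)
    also have "?S\<^sup>*\<^sup>* (2 * n + 3, (b @ a) @ [0]) (2 * n + 3, [0] @ b @ a)"
      by (rule rot) (use w nr in auto)
    also have "?S (2 * n + 3, [0] @ b @ a) (2 * z + 2, (b @ a) @ [0])"
      using hash(2)[of "b @ a"] by simp
    finally have "?S\<^sup>*\<^sup>* (2 * n + 2, w) (2 * z + 2, (b @ a) @ [0])" by (simp add: w)
    moreover have "queue_repr ((b @ a) @ [0]) (s(r := s r - 1))"
      using assms(3) True unfolding w queue_repr_def by (auto simp: add.commute)
    ultimately show ?thesis using that True by simp
  next
    case False
    have "r + 2 \<in> set w"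
      using assms(3) False unfolding queue_repr_def by (metis count_notin)
    then obtain a b where w: "w = a @ (r + 2) # b" "r + 2 \<notin> set a"
      by (meson split_list_first)
    \<comment> \<open>The end marker may precede the first unit, which changes the state to
      \<open>2 * n + 3\<close>. Being unique, it cannot come up a second time before the
      unit.\<close>
    have "\<exists>q. (q = 2 * n + 2 \<or> q = 2 * n + 3) \<and> ?S\<^sup>*\<^sup>* (2 * n + 2, w) (q, (r + 2) # b @ a)"
    proof (cases "0 \<in> set a")
      case False
      then show ?thesis
        using rot[of "2 * n + 2" a "(r + 2) # b"] w by auto
    next
      case True
      then obtain a1 a2 where a: "a = a1 @ 0 # a2" "0 \<notin> set a1" by (meson split_list_first)
      have "count_list w 0 = 1" using assms(3) by (simp add: queue_repr_def)
      then have a2: "0 \<notin> set a2" by (auto simp: w a count_list_0_iff)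
      have "?S\<^sup>*\<^sup>* (2 * n + 2, w) (2 * n + 2, 0 # a2 @ (r + 2) # b @ a1)"
        using rot[of "2 * n + 2" a1 "0 # a2 @ (r + 2) # b"] w a by simp
      also have "?S (2 * n + 2, 0 # a2 @ (r + 2) # b @ a1) (2 * n + 3, (a2 @ (r + 2) # b @ a1) @ [0])"
        by (rule hash)
      also have "?S\<^sup>*\<^sup>* (2 * n + 3, (a2 @ (r + 2) # b @ a1) @ [0]) (2 * n + 3, (r + 2) # b @ a)"
        using rot[of "2 * n + 3" a2 "(r + 2) # b @ a1 @ [0]"] w a a2 by simp
      finally show ?thesis by blast
    qed
    then obtain q where q: "q = 2 * n + 2 \<or> q = 2 * n + 3" "?S\<^sup>*\<^sup>* (2 * n + 2, w) (q, (r + 2) # b @ a)"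
      by blast
    then have "?S\<^sup>*\<^sup>* (2 * n + 2, w) (2 * e + 2, (b @ a) @ [1])"
      using unit[OF q(1), of "b @ a"] by simp
    moreover have "count_list ((b @ a) @ [1]) y = count_list w y - (if y = r + 2 then 1 else 0)"
      if "y \<noteq> 1" for y
      using that by (simp add: w)
    then have "queue_repr ((b @ a) @ [1]) (s(r := s r - 1))"
      using assms(3) by (auto simp: queue_repr_def)
    ultimately show ?thesis using that False by simp
  qed
qed

text \<open>Induction over the execution. The two loop rules correspond to the two exits of the
  \<open>DEC\<close> at address \<open>n\<close>; the body returns to \<open>n\<close>, where the
  hypothesis for the remaining rounds applies to the same code.\<close>

lemma queue_exec:
  assumes "exec c s s'" "code_at P n (code c n e)" "queue_repr w s"
  shows "\<exists>w'. (queue_step P)\<^sup>*\<^sup>* (2 * n + 2, w) (2 * e + 2, w') \<and> queue_repr w' s'"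
  using assms
proof (induction arbitrary: n e w rule: exec.induct)
  case (exec_Inc r s)
  then obtain w' where "queue_step P (2 * n + 2, w) (2 * e + 2, w')" "queue_repr w' (s(r := Suc (s r)))"
    using queue_INC[of n P r e w s] by auto
  then show ?case by blast
next
  case (exec_Dec r s)
  then have "n < length P" "P ! n = DEC r e e" by simp_all
  from queue_DEC[OF this exec_Dec.prems(2)] show ?case
    unfolding if_cancel by blast
next
  case (exec_Seq c s s' d s'')
  let ?m = "n + code_size c"
  obtain w1 where w1: "(queue_step P)\<^sup>*\<^sup>* (2 * n + 2, w) (2 * ?m + 2, w1)" "queue_repr w1 s'"
    using exec_Seq.IH(1)[of n ?m w] exec_Seq.prems by auto
  obtain w2 where w2: "(queue_step P)\<^sup>*\<^sup>* (2 * ?m + 2, w1) (2 * e + 2, w2)" "queue_repr w2 s''"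
    using exec_Seq.IH(2)[of ?m e w1] exec_Seq.prems w1(2) by auto
  from rtranclp_trans[OF w1(1) w2(1)] w2(2) show ?case by blast
next
  case (exec_Loop_0 s r c)
  then have "n < length P" "P ! n = DEC r (Suc n) e" by simp_all
  from queue_DEC[OF this exec_Loop_0.prems(2)] obtain w' where w':
    "(queue_step P)\<^sup>*\<^sup>* (2 * n + 2, w) (2 * (if s r = 0 then e else Suc n) + 2, w')"
    "queue_repr w' (s(r := s r - 1))" .
  have "s(r := s r - 1) = s" using exec_Loop_0.hyps by auto
  with w' exec_Loop_0.hyps show ?case by auto
next
  case (exec_Loop_Suc s r c s' s'')
  obtain w1 where w1: "(queue_step P)\<^sup>*\<^sup>* (2 * n + 2, w) (2 * Suc n + 2, w1)"
    "queue_repr w1 (s(r := s r - 1))"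
  proof (rule queue_DEC[OF _ _ exec_Loop_Suc.prems(2)])
    show "n < length P" "P ! n = DEC r (Suc n) e" using exec_Loop_Suc.prems(1) by simp_all
  qed (use exec_Loop_Suc.hyps(1) that in simp)
  obtain w2 where w2: "(queue_step P)\<^sup>*\<^sup>* (2 * Suc n + 2, w1) (2 * n + 2, w2)" "queue_repr w2 s'"
    using exec_Loop_Suc.IH(1)[of "Suc n" n w1, OF _ w1(2)] exec_Loop_Suc.prems(1) by auto
  obtain w3 where w3: "(queue_step P)\<^sup>*\<^sup>* (2 * n + 2, w2) (2 * e + 2, w3)" "queue_repr w3 s''"
    using exec_Loop_Suc.IH(2)[of n e w2] exec_Loop_Suc.prems w2(2) by blast
  from rtranclp_trans[OF w1(1) rtranclp_trans[OF w2(1) w3(1)]] w3(2) show ?case by blast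
qed

text \<open>Divergence alone would not do for unbounded trailing, as the queue might stay bounded.
  An \<open>INC\<close> that jumps to itself adds a letter in every step.\<close>

lemma queue_INC_forever:
  assumes "n < length P" "P ! n = INC r n" "w \<noteq> []"
  shows "\<exists>w'. (queue_step P)\<^sup>*\<^sup>* (2 * n + 2, w) (2 * n + 2, w') \<and> w' \<noteq> [] \<and> t \<le> length w'"
proof (induction t)
  case 0
  then show ?case using assms by blast
next
  case (Suc t)
  then obtain x v where v: "(queue_step P)\<^sup>*\<^sup>* (2 * n + 2, w) (2 * n + 2, x # v)" "t \<le> Suc (length v)"
    by (metis length_Cons list.exhaust)
  have "queue_step P (2 * n + 2, x # v) (2 * n + 2, v @ [x, r + 2])"
    using assms by (intro queue_stepI) (simp add: queue_trans_def)
  with v(1) have "(queue_step P)\<^sup>*\<^sup>* (2 * n + 2, w) (2 * n + 2, v @ [x, r + 2])"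
    by (rule rtranclp.rtrancl_into_rtrancl)
  with v(2) show ?case by (intro exI[of _ "v @ [x, r + 2]"]) simp
qed


section \<open>The transducer of a queue machine\<close>

text \<open>The transition that writes the initial queue is left out, so that this part does not
  depend on the initial queue and can be coded before that word is chosen.\<close>

definition base_trans :: "instr list \<Rightarrow> nat \<Rightarrow> nat \<Rightarrow> (nat \<times> nat list) set" where
  "base_trans P q x =
    (if q = 0 then if x = 0 then {(1, [])} else {}
     else if q = 1 then {(1, [x])}
     else set_option (queue_trans P q x))"

text \<open>The first letter, necessarily 0, is spent on choosing between the copying state 1 and
  state 2, which stands for address 0 of the machine. All states accept, so every run counts. One
  bound \<open>K\<close> for states and both alphabets lets them share one listing.\<close>

definition queue_nft :: "instr list \<Rightarrow> nat \<Rightarrow> nat list \<Rightarrow> (nat, nat, nat) nft" where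
  "queue_nft P K w =
    \<lparr>states = {..<K}, input_alphabet = {..<K}, output_alphabet = {..<K},
     delta = (\<lambda>q x. base_trans P q x \<union> (if q = 0 \<and> x = 0 then {(2, w)} else {})),
     initial = 0, accepting = {..<K}\<rparr>"

lemma queue_nft_simps [simp]:
  "states (queue_nft P K w) = {..<K}" "input_alphabet (queue_nft P K w) = {..<K}"
  "output_alphabet (queue_nft P K w) = {..<K}" "initial (queue_nft P K w) = 0"
  "accepting (queue_nft P K w) = {..<K}"
  "delta (queue_nft P K w) 0 x = (if x = 0 then {(1, []), (2, w)} else {})"
  "delta (queue_nft P K w) (Suc 0) x = {(1, [x])}"
  "2 \<le> q \<Longrightarrow> delta (queue_nft P K w) q x = set_option (queue_trans P q x)"
  by (auto simp: queue_nft_def base_trans_def)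

definition closed_below :: "nat \<Rightarrow> instr list \<Rightarrow> bool" where
  "closed_below K P \<longleftrightarrow>
    (\<forall>q x p u. x < K \<longrightarrow> queue_trans P q x = Some (p, u) \<longrightarrow> p < K \<and> set u \<subseteq> {..<K})"

lemma closed_below_exists: "\<exists>K\<ge>4. closed_below K P"
proof -
  \<comment> \<open>\<open>b\<close> exceeds every target state and letter that an instruction
    introduces, including jumps out of the program.\<close>
  define b where "b i = (case i of INC r e \<Rightarrow> r + 2 * e + 5 | DEC r e z \<Rightarrow> r + 2 * e + 2 * z + 5)" for i
  let ?K = "2 * length P + 4 + sum_list (map b P)"
  have le: "b (P ! n) < ?K" if "n < length P" for n
    using elem_le_sum_list[of n "map b P"] that by simp
  have "closed_below ?K P"
    unfolding closed_below_def
  proof (intro allI impI)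
    fix q x p u assume x: "x < ?K" and t: "queue_trans P q x = Some (p, u)"
    let ?n = "(q - 2) div 2"
    have n: "?n < length P" "2 \<le> q" using t by (auto simp: queue_trans_def split: if_splits)
    have q: "q + 1 < ?K" using n by linarith
    show "p < ?K \<and> set u \<subseteq> {..<?K}"
      using le[OF n(1)] t x q n
      by (auto simp: queue_trans_def b_def simp del: add_2_eq_Suc' split: if_splits instr.splits)
  qed
  then show ?thesis by (intro exI[of _ ?K]) simp
qed

section \<open>Runs of the transducer and computations of the queue machine\<close>

inductive_cases run_NilE: "run T q [] u p"
inductive_cases run_ConsE: "run T q (x # a) u p"

text \<open>Determinism forces every path from \<open>x\<close> to follow the one to
  \<open>y\<close>, which cannot be continued.\<close>

lemma deterministic_path_le:
  assumes "(R ^^ N) x y" "\<And>z. \<not> R y z" "(R ^^ k) x z" "\<And>a b c. R a b \<Longrightarrow> R a c \<Longrightarrow> b = c"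
  shows "k \<le> N"
  using assms(1,3)
proof (induction N arbitrary: x k)
  case 0
  show ?case
  proof (cases k)
    case (Suc k')
    with 0 obtain x' where "R x x'" by (metis relpowp_Suc_D2)
    with 0(1) assms(2) show ?thesis by simp
  qed simp
next
  case (Suc N)
  show ?case
  proof (cases k)
    case (Suc k')
    with Suc.prems obtain x1 x2 where "R x x1" "(R ^^ N) x1 y" "R x x2" "(R ^^ k') x2 z"
      by (metis relpowp_Suc_D2)
    with Suc Suc.IH assms(4) show ?thesis by blast
  qed simp
qed

context
  fixes P K w T
  assumes K: "4 \<le> K" and closed: "closed_below K P" and w: "set w \<subseteq> {..<K}" "w \<noteq> []"
  defines "T \<equiv> queue_nft P K w"
begin

lemma queue_trans_closed:
  assumes "x < K" "queue_trans P q x = Some (p, u)"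
  shows "p < K" "set u \<subseteq> {..<K}"
  using closed assms unfolding closed_below_def by blast+

lemma queue_nft_is_nft: "is_nft T"
proof -
  have "finite (delta T q x) \<and> delta T q x \<subseteq> {..<K} \<times> lists {..<K}" if "q < K" "x < K" for q x
  proof -
    consider "q = 0" | "q = Suc 0" | "2 \<le> q" by linarith
    then show ?thesis
    proof cases
      case 3
      show ?thesis
      proof (cases "queue_trans P q x")
        case (Some pu)
        obtain p u where pu: "pu = (p, u)" by fastforce
        with 3 Some queue_trans_closed[of x q p u] that show ?thesis
          by (simp add: T_def lists_eq_set)
      qed (use 3 in \<open>simp add: T_def\<close>)
    qed (use K w that in \<open>auto simp: T_def\<close>)
  qed
  with K show ?thesis
    unfolding is_nft_def by (auto simp: T_def lessThan_empty_iff)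
qed

lemma run_copy: "set a \<subseteq> {..<K} \<Longrightarrow> run T 1 a a 1"
proof (induction a)
  case Nil
  then show ?case using K by (auto simp: T_def intro!: run_Nil)
next
  case (Cons x a)
  then have "run T 1 (x # a) ([x] @ a) 1"
    using K by (intro run_Cons) (auto simp: T_def)
  then show ?case by simp
qed

lemma run_copyD: "run T 1 a u q \<Longrightarrow> u = a \<and> q = 1"
proof (induction a arbitrary: u)
  case Nil
  then show ?case by (auto elim: run_NilE)
next
  case (Cons x a)
  from Cons.prems show ?case
    by (rule run_ConsE) (use Cons.IH in \<open>auto simp: T_def\<close>)
qed

lemma run_initialD:
  assumes "run T 0 a u q"
  shows "(a = [] \<and> u = []) \<or>
    (\<exists>a'. a = 0 # a' \<and> (u = a' \<or> (\<exists>u'. u = w @ u' \<and> run T 2 a' u' q)))"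
proof (cases a)
  case Nil
  with assms show ?thesis by (auto elim: run_NilE)
next
  case (Cons x a')
  from assms[unfolded Cons] obtain p u1 u2 where
    "(p, u1) \<in> delta T 0 x" "run T p a' u2 q" "u = u1 @ u2"
    by (rule run_ConsE)
  with Cons show ?thesis
    using run_copyD by (auto simp: T_def split: if_splits)
qed

lemma run_queue_ConsE:
  assumes "run T q (x # a) u q'" "2 \<le> q"
  obtains p u1 u2 where "queue_trans P q x = Some (p, u1)" "u = u1 @ u2" "run T p a u2 q'" "2 \<le> p"
    "1 \<le> length u1" "length u1 \<le> 2"
  using assms(1)
proof (rule run_ConsE)
  fix p u1 u2 assume *: "u = u1 @ u2" "(p, u1) \<in> delta T q x" "run T p a u2 q'"
  then have "queue_trans P q x = Some (p, u1)"
    using assms(2) by (simp add: T_def elem_set)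
  with * that queue_trans_output[OF this] show thesis by blast
qed

lemma run_queue_deterministic:
  "run T q a u p \<Longrightarrow> run T q a u' p' \<Longrightarrow> 2 \<le> q \<Longrightarrow> u = u'"
proof (induction a arbitrary: q u u')
  case Nil
  then show ?case by (auto elim: run_NilE)
next
  case (Cons x a)
  obtain p1 u1 u2 where 1: "queue_trans P q x = Some (p1, u1)" "u = u1 @ u2" "run T p1 a u2 p" "2 \<le> p1"
    using run_queue_ConsE[OF Cons.prems(1,3)] .
  obtain p1' u1' u2' where 2: "queue_trans P q x = Some (p1', u1')" "u' = u1' @ u2'" "run T p1' a u2' p'"
    using run_queue_ConsE[OF Cons.prems(2,3)] .
  from 1 2 Cons.IH[OF 1(3) _ 1(4)] show ?case by simp
qed

lemma run_queue_length:
  "run T q a u p \<Longrightarrow> 2 \<le> q \<Longrightarrow> length a \<le> length u \<and> length u \<le> 2 * length a"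
proof (induction a arbitrary: q u)
  case Nil
  then show ?case by (auto elim: run_NilE)
next
  case (Cons x a)
  obtain p1 u1 u2 where 1: "u = u1 @ u2" "run T p1 a u2 p" "2 \<le> p1" "1 \<le> length u1" "length u1 \<le> 2"
    using run_queue_ConsE[OF Cons.prems] .
  from 1 Cons.IH[OF 1(2,3)] show ?case by simp
qed

text \<open>Here \<open>z\<close> is the current queue and \<open>u\<close> is what will be
  enqueued. The equation makes the next input letter the head of the queue, and no step empties the
  queue; what is left over at the end is \<open>v\<close>.\<close>

lemma queue_steps_of_run:
  "run T q a u p \<Longrightarrow> 2 \<le> q \<Longrightarrow> a @ v = z @ u \<Longrightarrow> z \<noteq> [] \<Longrightarrow>
    ((queue_step P) ^^ length a) (q, z) (p, v)"
proof (induction a arbitrary: q u z)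
  case Nil
  then show ?case by (auto elim: run_NilE)
next
  case (Cons x a)
  obtain p1 u1 u2 where 1: "queue_trans P q x = Some (p1, u1)" "u = u1 @ u2" "run T p1 a u2 p" "2 \<le> p1"
    "1 \<le> length u1"
    using run_queue_ConsE[OF Cons.prems(1,2)] .
  obtain z' where z: "z = x # z'" "a @ v = (z' @ u1) @ u2"
    using Cons.prems(3,4) 1(2) by (cases z) auto
  have "queue_step P (q, z) (p1, z' @ u1)"
    unfolding z by (rule queue_stepI) (rule 1)
  moreover have "((queue_step P) ^^ length a) (p1, z' @ u1) (p, v)"
    by (rule Cons.IH[OF 1(3,4) z(2)]) (use 1(5) in auto)
  ultimately show ?case
    unfolding list.size add_Suc_right add_0_right by (rule relpowp_Suc_I2)
qed

text \<open>The input \<open>a\<close> consists of the letters that the machine dequeues. Bounding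
  the letters of \<open>z @ u\<close> bounds those of \<open>a\<close> and \<open>v\<close> as
  well.\<close>

lemma run_of_queue_steps:
  "((queue_step P) ^^ n) (q, z) (p, v) \<Longrightarrow> 2 \<le> q \<Longrightarrow> q < K \<Longrightarrow> set z \<subseteq> {..<K} \<Longrightarrow>
    \<exists>a u. run T q a u p \<and> a @ v = z @ u \<and> p < K \<and> set (z @ u) \<subseteq> {..<K}"
proof (induction n arbitrary: q z)
  case 0
  then show ?case
    by (intro exI[of _ "[]"]) (auto simp: T_def intro: run_Nil)
next
  case (Suc n)
  from relpowp_Suc_D2[OF Suc.prems(1)] obtain c where
    c: "queue_step P (q, z) c" "((queue_step P) ^^ n) c (p, v)"
    by blast
  from c(1) obtain x p1 u1 z' where
    1: "z = x # z'" "queue_trans P q x = Some (p1, u1)" "c = (p1, z' @ u1)"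
    by (auto elim: queue_step.cases)
  have 2: "2 \<le> p1" "p1 < K" "set u1 \<subseteq> {..<K}"
    using 1(1) queue_trans_output[OF 1(2)] queue_trans_closed[OF _ 1(2)] Suc.prems(4) by auto
  obtain a u where 3: "run T p1 a u p" "a @ v = (z' @ u1) @ u" "p < K" "set ((z' @ u1) @ u) \<subseteq> {..<K}"
    using Suc.IH[of p1 "z' @ u1"] c(2) 1 2 Suc.prems(4) by auto
  have "run T q (x # a) (u1 @ u) p"
    by (rule run_Cons[OF _ _ _ 3(1)]) (use 1 Suc.prems in \<open>auto simp: T_def\<close>)
  with 1 3 Suc.prems(4) show ?case
    by (intro exI[of _ "x # a"] exI[of _ "u1 @ u"]) auto
qed

lemma queue_nft_finite_valued: "finite_valued T"
  unfolding finite_valued_def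
proof (intro exI[of _ 3] ballI)
  fix a
  \<comment> \<open>By determinism the queue branch has at most one output; if it has no run on this
    input, any \<open>z\<close> will do.\<close>
  obtain z where z: "u = z" if "run T 2 (tl a) u q" for u q
    using run_queue_deterministic by (metis order_refl)
  \<comment> \<open>The three words come from the empty run, the copying branch and the queue
    branch.\<close>
  have sub: "{u. (a, u) \<in> nft_lang T} \<subseteq> {[], tl a, w @ z}"
  proof
    fix u assume "u \<in> {u. (a, u) \<in> nft_lang T}"
    then obtain f where "run T 0 a u f" by (auto simp: nft_lang_def T_def)
    from run_initialD[OF this] z show "u \<in> {[], tl a, w @ z}" by auto
  qed
  have "card {[], tl a, w @ z} \<le> 3"
    by (simp add: card_insert_if)
  with sub show "finite {u. (a, u) \<in> nft_lang T} \<and> card {u. (a, u) \<in> nft_lang T} \<le> 3"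
    by (meson card_mono finite.emptyI finite.insertI finite_subset le_trans)
qed

text \<open>A copying run that lags behind a queue run by \<open>v\<close> has read the letters dequeued so far, and
  \<open>v\<close> is the contents of the queue. A queue run never lags behind a copying run, since it writes
  at least as many letters as it reads.\<close>

lemma bounded_trailing_if_halting:
  assumes "(queue_step P)\<^sup>*\<^sup>* (2, w) c" "\<And>c'. \<not> queue_step P c c'"
  shows "bounded_trailing T"
proof -
  obtain N where N: "((queue_step P) ^^ N) (2, w) c"
    using assms(1) by (meson rtranclp_imp_relpowp)
  \<comment> \<open>The trailing word is a suffix of \<open>w\<close> followed by the output of at
    most \<open>N\<close> steps, each of which writes at most two letters.\<close>
  have "length v \<le> length w + 2 * N" if "run T 0 a (u @ v) q1" "run T 0 a u q2" for a u v q1 q2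
  proof -
    \<comment> \<open>Such a run reads exactly the letters that the machine dequeues, so it cannot
      outlast the halting computation.\<close>
    have halt: "length a' \<le> N" if "run T 2 a' u' q" "a' @ v' = w @ u'" for a' u' v' q
      using deterministic_path_le[OF N assms(2) queue_steps_of_run[OF that(1) _ that(2) w(2)]]
        queue_step_deterministic by blast
    from run_initialD[OF that(1)] show ?thesis
    proof (elim disjE exE conjE)
      \<comment> \<open>If the leading run copies, the other one has written at least as much, and
        \<open>v\<close> is empty.\<close>
      fix a' assume "a = 0 # a'" "u @ v = a'"
      with run_initialD[OF that(2)] show ?thesis
        by (auto dest: run_queue_length)
    next
      fix a' u1 assume 1: "a = 0 # a'" "u @ v = w @ u1" "run T 2 a' u1 q1"
      from run_initialD[OF that(2)] 1(1) consider "u = a'" | u2 where "u = w @ u2" "run T 2 a' u2 q2"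
        by auto
      then show ?thesis
      proof cases
        case 1
        with \<open>u @ v = w @ u1\<close> have "a' @ v = w @ u1" by simp
        moreover from this have "length a' + length v = length w + length u1"
          by (metis length_append)
        ultimately show ?thesis
          using halt[OF \<open>run T 2 a' u1 q1\<close>] run_queue_length[OF \<open>run T 2 a' u1 q1\<close>] by fastforce
      next
        case 2
        with run_queue_deterministic[OF 1(3) 2(2)] 1(2) show ?thesis by simp
      qed
    qed simp
  qed
  then show ?thesis
    unfolding bounded_trailing_def by (intro exI[of _ "length w + 2 * N"]) (auto simp: T_def)
qed

lemma unbounded_trailing_if_growing:
  assumes "\<And>t. \<exists>q v. (queue_step P)\<^sup>*\<^sup>* (2, w) (q, v) \<and> t \<le> length v"
  shows "\<not> bounded_trailing T"
proof
  assume "bounded_trailing T"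
  then obtain t where t: "\<forall>q1\<in>states T. \<forall>q2\<in>states T. \<forall>f1\<in>accepting T. \<forall>f2\<in>accepting T.
      \<forall>a\<in>lists (input_alphabet T). \<forall>b1\<in>lists (input_alphabet T). \<forall>b2\<in>lists (input_alphabet T).
      \<forall>u\<in>lists (output_alphabet T). \<forall>v\<in>lists (output_alphabet T).
      \<forall>w1\<in>lists (output_alphabet T). \<forall>w2\<in>lists (output_alphabet T).
        run T (initial T) a (u @ v) q1 \<and> run T q1 b1 w1 f1 \<and>
        run T (initial T) a u q2 \<and> run T q2 b2 (v @ w2) f2 \<longrightarrow> length v \<le> t"
    unfolding bounded_trailing_def by (elim exE)
  obtain q v n where v: "((queue_step P) ^^ n) (2, w) (q, v)" "Suc t \<le> length v"
    using assms[of "Suc t"] by (metis rtranclp_imp_relpowp)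
  obtain a u where a: "run T 2 a u q" "a @ v = w @ u" "q < K" "set (w @ u) \<subseteq> {..<K}"
    using run_of_queue_steps[OF v(1)] K w by auto
  have sets: "set a \<subseteq> {..<K}" "set v \<subseteq> {..<K}"
    using a(4) unfolding a(2)[symmetric] by auto
  have "run T 0 (0 # a) (w @ u) q" "run T 0 (0 # a) ([] @ a) 1"
    by (rule run_Cons[OF _ _ _ a(1)] run_Cons[OF _ _ _ run_copy[OF sets(1)]];
        use K in \<open>simp add: T_def\<close>)+
  moreover have "run T q [] [] q" "run T 1 v v 1"
    using a(3) run_copy[OF sets(2)] by (auto simp: T_def intro: run_Nil)
  \<comment> \<open>The queue run has written \<open>a @ v\<close> where the copying run has written
    \<open>a\<close>; by reading \<open>v\<close> next, the latter catches up.\<close>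
  ultimately have "length v \<le> t"
    using K a(2,3) sets
    by (intro t[rule_format, of q 1 q 1 "0 # a" "[]" v a v "[]" "[]"]) (auto simp: T_def lists_eq_set)
  with v(2) show False by simp
qed

end

text \<open>\<open>D\<close> codes all transitions except the one carrying \<open>w\<close>. It is
  fixed before \<open>w\<close>, so \<open>w\<close> may be chosen depending on \<open>D\<close>;
  this is what makes the self-reference possible.\<close>

lemma queue_nft_code:
  assumes "4 \<le> K"
  shows "\<exists>D. \<forall>w. nft_code (queue_nft P K w)
    (list_encode [list_encode [0..<K], list_encode [0..<K], list_encode [0..<K],
      list_encode (encode_transition (0, 0, 2, w) # list_decode D), 0, list_encode [0..<K]])"
proof -
  let ?B = "{(q, x, p, u). q < K \<and> x < K \<and> (p, u) \<in> base_trans P q x}"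
  have "?B = (\<Union>q<K. \<Union>x<K. (\<lambda>(p, u). (q, x, p, u)) ` base_trans P q x)" by auto
  moreover have "finite (base_trans P q x)" for q x by (simp add: base_trans_def)
  ultimately have "finite ?B" by simp
  then obtain ds where ds: "set ds = ?B" using finite_list by blast
  show ?thesis
  proof (intro exI[of _ "list_encode (map encode_transition ds)"] allI)
    fix w
    have "set ((0, 0, 2, w) # ds) =
        {(q, x, p, u). q < K \<and> x < K \<and> (p, u) \<in> delta (queue_nft P K w) q x}"
      using assms ds by (auto simp: queue_nft_def split: if_splits)
    then show "nft_code (queue_nft P K w)
      (list_encode [list_encode [0..<K], list_encode [0..<K], list_encode [0..<K],
        list_encode (encode_transition (0, 0, 2, w) # list_decode (list_encode (map encode_transition ds))),
        0, list_encode [0..<K]])"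
      unfolding nft_code_def
      by (intro exI[of _ "[0..<K]"] exI[of _ "(0, 0, 2, w) # ds"]) (simp add: atLeast0LessThan)
  qed
qed


section \<open>Diagonalisation\<close>

text \<open>The letters 2 and 3 are the units of registers 0 and 1, and 0 is the end marker: a queue
  holding the two arguments.\<close>

definition start_word :: "nat \<Rightarrow> nat \<Rightarrow> nat list" where
  "start_word A D = replicate A 2 @ replicate D 3 @ [0]"

definition start_word_rf :: recf where
  "start_word_rf = Comp (replicate_rf 2) [Proj 0, Comp (replicate_rf 3) [Proj 1, list_rf [Zero]]]"

lemma eval_start_word: "eval start_word_rf [A, D] (list_encode (start_word A D))"
proof -
  have "eval (list_rf [Zero]) [A, D] (list_encode [0])"
    by (rule eval_list) (simp add: eval_Zero)
  then show ?thesis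
    unfolding start_word_rf_def start_word_def
    by (intro eval_Comp2[OF eval_Proj_eq eval_Comp2[OF eval_Proj_eq _ eval_replicate] eval_replicate]) auto
qed

text \<open>In the manner of a quine, the code of a transducer is rebuilt from \<open>A\<close> and
  \<open>D\<close>, including the initial queue that spells out \<open>A\<close> and
  \<open>D\<close>. The argument \<open>A\<close> is to be the common listing of states, alphabets
  and accepting states.\<close>

definition instance_rf :: recf where
  "instance_rf = list_rf [Proj 0, Proj 0, Proj 0,
     Comp cons_rf [list_rf [Zero, Zero, const_rf 2, start_word_rf], Proj 1], Zero, Proj 0]"

lemma eval_instance:
  "eval instance_rf [A, D] (list_encode [A, A, A,
    list_encode (encode_transition (0, 0, 2, start_word A D) # list_decode D), 0, A])"
proof -
  have "eval (list_rf [Zero, Zero, const_rf 2, start_word_rf]) [A, D]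
      (encode_transition (0, 0, 2, start_word A D))"
    unfolding encode_transition_def prod.case
    by (rule eval_list) (simp add: eval_Zero eval_const eval_start_word)
  moreover have "eval (Proj 1) [A, D] (list_encode (list_decode D))"
    by (rule eval_Proj_eq) simp_all
  ultimately show ?thesis
    unfolding instance_rf_def
    by (intro eval_list list_all2_Cons[THEN iffD2] conjI eval_Comp_cons eval_Proj_eq eval_Zero) simp_all
qed

lemma queue_repr_start_word: "queue_repr (start_word A D) ((\<lambda>_. 0)(0 := A, 1 := D))"
proof -
  have "count_list (replicate n x) y = (if x = y then n else 0)" for n x and y :: nat
    by (induction n) auto
  then show ?thesis
    by (auto simp: queue_repr_def start_word_def)
qed

theorem theorem3:
  "\<not> decidable_given nft_code (\<lambda>T. is_nft T \<and> finite_valued T) bounded_trailing"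
proof
  assume "decidable_given nft_code (\<lambda>T. is_nft T \<and> finite_valued T) bounded_trailing"
  then obtain d where d: "eval d [c] (if bounded_trailing T then 1 else 0)"
    if "is_nft T" "finite_valued T" "nft_code T c" for T c
    unfolding decidable_given_def by blast
  define c where "c = compile (Comp d [instance_rf]) [0, 1] 2 3"
  define N where "N = code_size c"
  \<comment> \<open>Address \<open>N\<close> tests the answer of \<open>d\<close> in register 2: a
    positive answer leads to incrementing forever at \<open>N + 1\<close>, and 0 leads to
    \<open>N + 2\<close>, just outside the program.\<close>
  define P where "P = code c 0 N @ [DEC 2 (N + 1) (N + 2), INC 0 (N + 1)]"
  \<comment> \<open>There is no circularity: \<open>P\<close> depends only on \<open>d\<close>, and
    \<open>K\<close>, \<open>A\<close> and \<open>D\<close> only on \<open>P\<close>, so that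
    \<open>w\<close> can be chosen last.\<close>
  obtain K where K: "4 \<le> K" "closed_below K P" using closed_below_exists by blast
  define A where "A = list_encode [0..<K]"
  obtain D where D: "\<And>w. nft_code (queue_nft P K w)
      (list_encode [A, A, A, list_encode (encode_transition (0, 0, 2, w) # list_decode D), 0, A])"
    using queue_nft_code[OF K(1), of P] unfolding A_def by blast
  define w where "w = start_word A D"
  define T where "T = queue_nft P K w"
  have w: "set w \<subseteq> {..<K}" "w \<noteq> []"
    using K(1) by (auto simp: w_def start_word_def)
  note params = K w
  define b :: nat where "b = (if bounded_trailing T then 1 else 0)"
  \<comment> \<open>The transducer satisfies the promise, so \<open>d\<close> halts on its code with
    the right answer.\<close>
  have "eval d [list_encode [A, A, A, list_encode (encode_transition (0, 0, 2, w) # list_decode D), 0, A]] b"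
    unfolding b_def T_def
    by (rule d[OF queue_nft_is_nft[OF params] queue_nft_finite_valued[OF params] D])
  then have ev: "eval (Comp d [instance_rf]) [A, D] b"
    unfolding w_def by (rule eval_Comp1[OF eval_instance])
  let ?s = "(\<lambda>_. 0)(0 := A, 1 := D)"
  obtain s where s: "exec c ?s s" "s 2 = b"
    unfolding c_def by (rule compile_specD[OF compile_correct ev, of ?s "[0, 1]" 3 2]) auto
  have "code_at P 0 (code c 0 N)"
    using code_at_infix[of "[]"] by (simp add: P_def)
  from queue_exec[OF s(1) this queue_repr_start_word]
  obtain w1 where w1: "(queue_step P)\<^sup>*\<^sup>* (2, w) (2 * N + 2, w1)" "queue_repr w1 s"
    unfolding w_def mult_0_right add_0 by (elim exE conjE)
  have N: "length P = N + 2" "P ! N = DEC 2 (N + 1) (N + 2)" "P ! (N + 1) = INC 0 (N + 1)"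
    by (simp_all add: P_def N_def nth_append)
  have "N < length P" by (simp add: N)
  from queue_DEC[OF this N(2) w1(2)] obtain w2 where
    w2: "(queue_step P)\<^sup>*\<^sup>* (2 * N + 2, w1) (2 * (if b = 0 then N + 2 else N + 1) + 2, w2)"
      "queue_repr w2 (s(2 := s 2 - 1))"
    unfolding s(2) .
  note run = rtranclp_trans[OF w1(1) w2(1)]
  show False
  proof (cases "bounded_trailing T")
    case True
    then have "(queue_step P)\<^sup>*\<^sup>* (2, w) (2 * (N + 1) + 2, w2)"
      using run by (simp add: b_def)
    moreover have "w2 \<noteq> []" using w2(2) by (auto simp: queue_repr_def)
    then have "\<exists>w'. (queue_step P)\<^sup>*\<^sup>* (2 * (N + 1) + 2, w2) (2 * (N + 1) + 2, w') \<and> w' \<noteq> [] \<and> t \<le> length w'" for t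
      by (intro queue_INC_forever) (use N in auto)
    ultimately have "\<exists>q v. (queue_step P)\<^sup>*\<^sup>* (2, w) (q, v) \<and> t \<le> length v" for t
      using rtranclp_trans[of "queue_step P"] by blast
    with True show False
      using unbounded_trailing_if_growing[OF params] unfolding T_def by simp
  next
    case False
    then have "(queue_step P)\<^sup>*\<^sup>* (2, w) (2 * (N + 2) + 2, w2)"
      using run by (simp add: b_def)
    \<comment> \<open>\<open>N + 2\<close> is the length of \<open>P\<close>, so no transition is
      defined in this state.\<close>
    moreover have "\<not> queue_step P (2 * (N + 2) + 2, w2) c'" for c'
      by (auto simp: queue_trans_def N elim!: queue_step.cases)
    ultimately show False
      using bounded_trailing_if_halting[OF params] False unfolding T_def by blast
  qed
qed

end
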